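(* If $\Gamma\vdash C_r\rhd\Xi$ is derivable in implicit ordered adjoint natural deduction, then $\Gamma\vdash C_r\dashv\Omega$ is derivable in ordered adjoint natural deduction with explicit structural rules for every $\Omega\in\Xi$.
   Context: Modes and propositions. Fix a preorder $(\mathcal{M},\geq)$ of modes and, for each mode $m$, a set $\sigma(m)\subseteq\{\mathsf{W},\mathsf{C}^\leftarrow,\mathsf{C}^\rightarrow,\mathsf{M}^\leftarrow,\mathsf{M}^\rightarrow\}$, monotone ($k\geq m$ implies $\sigma(k)\supseteq\sigma(m)$), and satisfying: if $\mathsf{W},\mathsf{C}^\leftarrow\in\sigma(m)$ then $\mathsf{M}^\leftarrow\in\sigma(m)$; if $\mathsf{W},\mathsf{C}^\rightarrow\in\sigma(m)$ then $\mathsf{M}^\rightarrow\in\sigma(m)$. Propositions: $A_m ::= P_m \mid A_m \rightarrowtail B_m \mid A_m \twoheadrightarrow B_m \mid A_m \,\&\, B_m \mid {\uparrow}^m_l A_l\ (m\geq l) \mid A_m\bullet B_m \mid 1_m \mid A_m\oplus B_m \mid {\downarrow}^k_m A_k\ (k\geq m)$. An ordered context $\Omega$ is a finite sequence of labeled hypotheses $x{:}A_m$ (repetitions allowed, same variable always same proposition); $|\Omega|$ its variable set; $\Omega\geq m$ means all its hypotheses $y{:}B_k$ have $k\geq m$; $\Omega$ is normal if no variable repeats. Explicit natural deduction $\Gamma\vdash A_m\dashv\Omega$ ($\Gamma$ unordered set of hypotheses, $\Omega$ ordered used hypotheses). Rules: (hyp) $x{:}A_m\in\Gamma\Rightarrow\Gamma\vdash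 A_m\dashv(x{:}A_m)$; ($1I$) $\Rightarrow\Gamma\vdash1_m\dashv\cdot$; ($1E$) $\Gamma\vdash1_m\dashv\Omega_M$, $m\geq r$, $\Gamma\vdash C_r\dashv\Omega_L\Omega_R\Rightarrow\Gamma\vdash C_r\dashv\Omega_L\Omega_M\Omega_R$; ($\bullet I$) $\Gamma\vdash A_m\dashv\Omega_L,\Gamma\vdash B_m\dashv\Omega_R\Rightarrow\Gamma\vdash A_m\bullet B_m\dashv\Omega_L\Omega_R$; ($\bullet E$) $\Gamma\vdash A_m\bullet B_m\dashv\Omega_M$, $m\geq r$, $x,y\notin|\Omega_L\Omega_R|$, $\Gamma,x{:}A_m,y{:}B_m\vdash C_r\dashv\Omega_L(x{:}A_m)(y{:}B_m)\Omega_R\Rightarrow\Gamma\vdash C_r\dashv\Omega_L\Omega_M\Omega_R$; ($\oplus I_i$) $\Gamma\vdash A_m\dashv\Omega$ (resp. $B_m$) $\Rightarrow\Gamma\vdash A_m\oplus B_m\dashv\Omega$; ($\oplus E$) $\Gamma\vdash A_m\oplus B_m\dashv\Omega_M$, $m\geq r$, $x\notin|\Omega_L\Omega_R|$, $\Gamma,x{:}A_m\vdash C_r\dashv\Omega_L(x{:}A_m)\Omega_R$, $\Gamma,x{:}B_m\vdash C_r\dashv\Omega_L(x{:}B_m)\Omega_R\Rightarrow\Gamma\vdash C_r\dashv\Omega_L\Omega_M\Omega_R$; (${\downarrow}I$) $\Gamma\vdash A_k\dashv\Omega\Rightarrow\Gamma\vdash{\downarrow}^k_mA_k\dashv\Omega$;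 (${\downarrow}E$) $\Gamma\vdash{\downarrow}^k_mA_k\dashv\Omega_M$, $m\geq r$, $\Gamma,x{:}A_k\vdash C_r\dashv\Omega_L(x{:}A_k)\Omega_R$, $x\notin|\Omega_L\Omega_R|\Rightarrow\Gamma\vdash C_r\dashv\Omega_L\Omega_M\Omega_R$; ($\twoheadrightarrow I$) $\Gamma,x{:}A_m\vdash B_m\dashv\Omega(x{:}A_m)$, $x\notin|\Omega|\Rightarrow\Gamma\vdash A_m\twoheadrightarrow B_m\dashv\Omega$; ($\twoheadrightarrow E$) $\Gamma\vdash A_m\twoheadrightarrow B_m\dashv\Omega_L,\Gamma\vdash A_m\dashv\Omega_R\Rightarrow\Gamma\vdash B_m\dashv\Omega_L\Omega_R$; ($\rightarrowtail I$) $\Gamma,x{:}A_m\vdash B_m\dashv(x{:}A_m)\Omega$, $x\notin|\Omega|\Rightarrow\Gamma\vdash A_m\rightarrowtail B_m\dashv\Omega$; ($\rightarrowtail E$) $\Gamma\vdash A_m\rightarrowtail B_m\dashv\Omega_R,\Gamma\vdash A_m\dashv\Omega_L\Rightarrow\Gamma\vdash B_m\dashv\Omega_L\Omega_R$; ($\&I$) $\Gamma\vdash A_m\dashv\Omega,\Gamma\vdash B_m\dashv\Omega\Rightarrow\Gamma\vdash A_m\&B_m\dashv\Omega$; ($\&E_i$) $\Gamma\vdash A_m\&B_m\dashv\Omega\Rightarrow\Gamma\vdash A_m\dashv\Omega$ (resp. $B_m$); (${\uparrow}I$) $\Gamma\vdash A_l\dashv\Omega$, $\Omega\geq m\Rightarrow\Gamma\vdash{\uparrow}^m_lA_l\dashv\Omega$;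 (${\uparrow}E$) $\Gamma\vdash{\uparrow}^l_kA_k\dashv\Omega\Rightarrow\Gamma\vdash A_k\dashv\Omega$; structural: ($\mathsf{W}$) $\Gamma\vdash C_r\dashv\Omega_L\Omega_R$, $x{:}A_m\in\Gamma$, $m\geq r$, $\mathsf{W}\in\sigma(m)\Rightarrow\Gamma\vdash C_r\dashv\Omega_L(x{:}A_m)\Omega_R$; ($\mathsf{C}^\rightarrow$) $\Gamma\vdash C_r\dashv\Omega_L(x{:}A_m)\Omega_M(x{:}A_m)\Omega_R$, $\mathsf{C}^\rightarrow\in\sigma(m)\Rightarrow\Gamma\vdash C_r\dashv\Omega_L\Omega_M(x{:}A_m)\Omega_R$; ($\mathsf{C}^\leftarrow$) same premise, $\mathsf{C}^\leftarrow\in\sigma(m)\Rightarrow\Gamma\vdash C_r\dashv\Omega_L(x{:}A_m)\Omega_M\Omega_R$; ($\mathsf{M}^\rightarrow$) $\Gamma\vdash C_r\dashv\Omega_L(x{:}A_m)\Omega_M\Omega_R$, $\mathsf{M}^\rightarrow\in\sigma(m)\Rightarrow\Gamma\vdash C_r\dashv\Omega_L\Omega_M(x{:}A_m)\Omega_R$; ($\mathsf{M}^\leftarrow$) $\Gamma\vdash C_r\dashv\Omega_L\Omega_M(x{:}A_m)\Omega_R$, $\mathsf{M}^\leftarrow\in\sigma(m)\Rightarrow\Gamma\vdash C_r\dashv\Omega_L(x{:}A_m)\Omega_M\Omega_R$. Context reduction $\Omega\leadsto^{\Gamma}_{r}\Omega'$: generated by (W) $\Omega_L(x{:}A_m)\Omega_R\leadsto\Omega'$,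 $\mathsf{W}\in\sigma(m)$, $m\geq r$, $x{:}A_m\in\Gamma$, $x\notin|\Omega_L\Omega_R|\Rightarrow\Omega_L\Omega_R\leadsto\Omega'$; ($\mathsf{C}^\leftarrow$) $\Omega_L(x{:}A_m)\Omega_M\Omega_R\leadsto\Omega'$, $\mathsf{C}^\leftarrow\in\sigma(m)\Rightarrow\Omega_L(x{:}A_m)\Omega_M(x{:}A_m)\Omega_R\leadsto\Omega'$; ($\mathsf{C}^\rightarrow$) $\Omega_L\Omega_M(x{:}A_m)\Omega_R\leadsto\Omega'$, $\mathsf{C}^\rightarrow\in\sigma(m)\Rightarrow\Omega_L(x{:}A_m)\Omega_M(x{:}A_m)\Omega_R\leadsto\Omega'$; ($\mathsf{M}^\leftarrow$) $\Omega_L(x{:}A_m)\Omega_M\Omega_R\leadsto\Omega'$, $\mathsf{M}^\leftarrow\in\sigma(m)\Rightarrow\Omega_L\Omega_M(x{:}A_m)\Omega_R\leadsto\Omega'$; ($\mathsf{M}^\rightarrow$) $\Omega_L\Omega_M(x{:}A_m)\Omega_R\leadsto\Omega'$, $\mathsf{M}^\rightarrow\in\sigma(m)\Rightarrow\Omega_L(x{:}A_m)\Omega_M\Omega_R\leadsto\Omega'$; (id) $\Omega$ normal $\Rightarrow\Omega\leadsto\Omega$. $\mathsf{NF}_{\Gamma,r}(\Omega)=\{\Omega'\mid\Omega\leadsto^{\Gamma}_{r}\Omega'\}$, extended to sets $\Xi$ of contexts by union. For sets of contexts, $\Xi_1\Xi_2=\{\Omega_1\Omega_2\mid\Omega_i\in\Xi_i\}$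 and $\Xi\Vert_m=\{\Omega\in\Xi\mid\Omega\geq m\}$. Implicit natural deduction: judgment $\Gamma\vdash A_m\rhd\Xi$, with $\Xi$ a set of normal contexts; a rule applies only if its output set is nonempty; $\mathsf{NF}$ without subscript means $\mathsf{NF}_{\Gamma,r}$ with $r$ the mode of the conclusion's proposition. Rules: (hyp) $x{:}A_m\in\Gamma\Rightarrow\Gamma\vdash A_m\rhd\mathsf{NF}(\{x{:}A_m\})$; ($1I$) $\Rightarrow\Gamma\vdash1_m\rhd\mathsf{NF}(\{\cdot\})$; ($1E$) $\Gamma\vdash1_m\rhd\Xi_M$, $m\geq r$, $\Gamma\vdash C_r\rhd\Xi'\Rightarrow\Gamma\vdash C_r\rhd\mathsf{NF}(\{\Omega_L\Omega_M\Omega_R\mid\Omega_L\Omega_R\in\Xi',\Omega_M\in\Xi_M\})$ (over all splittings); ($\bullet I$) $\Gamma\vdash A_m\rhd\Xi_L$, $\Gamma\vdash B_m\rhd\Xi_R\Rightarrow\Gamma\vdash A_m\bullet B_m\rhd\mathsf{NF}_{\Gamma,m}(\Xi_L\Xi_R)$; ($\bullet E$) $\Gamma\vdash A_m\bullet B_m\rhd\Xi_M$, $m\geq r$, $\Gamma,x{:}A_m,y{:}B_m\vdash C_r\rhd\Xi\Rightarrow\Gamma\vdash C_r\rhd\mathsf{NF}(\{\Omega_L\Omega_M\Omega_R\mid\Omega_L(x{:}A_m)(y{:}B_m)\Omega_R\in\Xi,\Omega_M\in\Xi_M\})$; ($\oplus I_i$) $\Gamma\vdash A_m\rhd\Xi$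 (resp. $B_m$) $\Rightarrow\Gamma\vdash A_m\oplus B_m\rhd\Xi$; ($\oplus E$) $\Gamma\vdash A_m\oplus B_m\rhd\Xi_M$, $m\geq r$, $\Gamma,x{:}A_m\vdash C_r\rhd\Xi_A$, $\Gamma,x{:}B_m\vdash C_r\rhd\Xi_B\Rightarrow\Gamma\vdash C_r\rhd\mathsf{NF}(\{\Omega_L\Omega_M\Omega_R\mid\Omega_L(x{:}A_m)\Omega_R\in\Xi_A,\Omega_L(x{:}B_m)\Omega_R\in\Xi_B,\Omega_M\in\Xi_M\})$; (${\downarrow}I$) $\Gamma\vdash A_l\rhd\Xi\Rightarrow\Gamma\vdash{\downarrow}^l_mA_l\rhd\mathsf{NF}_{\Gamma,m}(\Xi)$; (${\downarrow}E$) $\Gamma\vdash{\downarrow}^l_mA_l\rhd\Xi_M$, $m\geq r$, $\Gamma,x{:}A_l\vdash C_r\rhd\Xi\Rightarrow\Gamma\vdash C_r\rhd\mathsf{NF}_{\Gamma,r}(\{\Omega_L\Omega_M\Omega_R\mid\Omega_L(x{:}A_l)\Omega_R\in\Xi,\Omega_M\in\Xi_M\})$; ($\twoheadrightarrow I$) $\Gamma,x{:}A_m\vdash B_m\rhd\Xi'\Rightarrow\Gamma\vdash A_m\twoheadrightarrow B_m\rhd\{\Omega\mid\Omega(x{:}A_m)\in\Xi'\}$; ($\twoheadrightarrow E$) $\Gamma\vdash A_m\twoheadrightarrow B_m\rhd\Xi_L$, $\Gamma\vdash A_m\rhd\Xi_R\Rightarrow\Gamma\vdash B_m\rhd\mathsf{NF}(\Xi_L\Xi_R)$;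 ($\rightarrowtail I$) $\Gamma,x{:}A_m\vdash B_m\rhd\Xi'\Rightarrow\Gamma\vdash A_m\rightarrowtail B_m\rhd\{\Omega\mid(x{:}A_m)\Omega\in\Xi'\}$; ($\rightarrowtail E$) $\Gamma\vdash A_m\rightarrowtail B_m\rhd\Xi_R$, $\Gamma\vdash A_m\rhd\Xi_L\Rightarrow\Gamma\vdash B_m\rhd\mathsf{NF}(\Xi_L\Xi_R)$; ($\&I$) $\Gamma\vdash A_m\rhd\Xi_A$, $\Gamma\vdash B_m\rhd\Xi_B\Rightarrow\Gamma\vdash A_m\&B_m\rhd\Xi_A\cap\Xi_B$; ($\&E_i$) $\Gamma\vdash A_m\&B_m\rhd\Xi\Rightarrow\Gamma\vdash A_m\rhd\Xi$ (resp. $B_m$); (${\uparrow}I$) $\Gamma\vdash A_k\rhd\Xi\Rightarrow\Gamma\vdash{\uparrow}^m_kA_k\rhd\Xi\Vert_m$; (${\uparrow}E$) $\Gamma\vdash{\uparrow}^m_kA_k\rhd\Xi\Rightarrow\Gamma\vdash A_k\rhd\mathsf{NF}_{\Gamma,k}(\Xi)$. *)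

theory Defs
  imports Main
begin

text \<open>
  The suffix gives the direction of the arrow: contraction keeps the left (right) of the two
  occurrences, mobility moves a hypothesis to the left (right).
\<close>

datatype structural = Weak | ContrL | ContrR | MoveL | MoveR

definition structural_modes :: "('m::preorder \<Rightarrow> structural set) \<Rightarrow> bool" where
  "structural_modes \<sigma> \<longleftrightarrow>
     (\<forall>k m. k \<ge> m \<longrightarrow> \<sigma> k \<supseteq> \<sigma> m) \<and>
     (\<forall>m. Weak \<in> \<sigma> m \<and> ContrL \<in> \<sigma> m \<longrightarrow> MoveL \<in> \<sigma> m) \<and>
     (\<forall>m. Weak \<in> \<sigma> m \<and> ContrR \<in> \<sigma> m \<longrightarrow> MoveR \<in> \<sigma> m)"


text \<open>
  Raw propositions; the mode-indexed grammar is recovered by \<open>wf_adj_prop\<close>.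
  \<open>ImpL A B\<close> takes its argument on the left of the context (\<open>A \<rightarrowtail> B\<close>) and \<open>ImpR A B\<close> on the
  right.  In \<open>Up m A\<close> and \<open>Down m A\<close> the mode \<open>m\<close> is the mode of the resulting proposition;
  the other index of the shift is \<open>mode A\<close>.
\<close>

datatype ('m, 'p) adj_prop =
    Atom 'm 'p
  | ImpL "('m, 'p) adj_prop" "('m, 'p) adj_prop"
  | ImpR "('m, 'p) adj_prop" "('m, 'p) adj_prop"
  | With "('m, 'p) adj_prop" "('m, 'p) adj_prop"
  | Up 'm "('m, 'p) adj_prop"
  | Fuse "('m, 'p) adj_prop" "('m, 'p) adj_prop"
  | One 'm
  | Plus "('m, 'p) adj_prop" "('m, 'p) adj_prop"
  | Down 'm "('m, 'p) adj_prop"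

primrec mode :: "('m, 'p) adj_prop \<Rightarrow> 'm" where
  "mode (Atom m P) = m"
| "mode (ImpL A B) = mode B"
| "mode (ImpR A B) = mode B"
| "mode (With A B) = mode B"
| "mode (Up m A) = m"
| "mode (Fuse A B) = mode B"
| "mode (One m) = m"
| "mode (Plus A B) = mode B"
| "mode (Down m A) = m"

primrec wf_adj_prop :: "('m::preorder, 'p) adj_prop \<Rightarrow> bool" where
  "wf_adj_prop (Atom m P) \<longleftrightarrow> True"
| "wf_adj_prop (ImpL A B) \<longleftrightarrow> wf_adj_prop A \<and> wf_adj_prop B \<and> mode A = mode B"
| "wf_adj_prop (ImpR A B) \<longleftrightarrow> wf_adj_prop A \<and> wf_adj_prop B \<and> mode A = mode B"
| "wf_adj_prop (With A B) \<longleftrightarrow> wf_adj_prop A \<and> wf_adj_prop B \<and> mode A = mode B"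
| "wf_adj_prop (Up m A) \<longleftrightarrow> wf_adj_prop A \<and> m \<ge> mode A"
| "wf_adj_prop (Fuse A B) \<longleftrightarrow> wf_adj_prop A \<and> wf_adj_prop B \<and> mode A = mode B"
| "wf_adj_prop (One m) \<longleftrightarrow> True"
| "wf_adj_prop (Plus A B) \<longleftrightarrow> wf_adj_prop A \<and> wf_adj_prop B \<and> mode A = mode B"
| "wf_adj_prop (Down m A) \<longleftrightarrow> wf_adj_prop A \<and> mode A \<ge> m"


type_synonym ('x, 'm, 'p) hyps = "('x \<times> ('m, 'p) adj_prop) set"
type_synonym ('x, 'm, 'p) ctx = "('x \<times> ('m, 'p) adj_prop) list"

definition wf_hyps :: "('x, 'm::preorder, 'p) hyps \<Rightarrow> bool" where
  "wf_hyps \<Gamma> \<longleftrightarrow> inj_on fst \<Gamma> \<and> (\<forall>(x, A) \<in> \<Gamma>. wf_adj_prop A)"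

abbreviation hyp_vars :: "('x, 'm, 'p) hyps \<Rightarrow> 'x set" where
  "hyp_vars \<Gamma> \<equiv> fst ` \<Gamma>"

abbreviation ctx_vars :: "('x, 'm, 'p) ctx \<Rightarrow> 'x set" where
  "ctx_vars \<Omega> \<equiv> fst ` set \<Omega>"

definition ctx_ge :: "('x, 'm::preorder, 'p) ctx \<Rightarrow> 'm \<Rightarrow> bool" where
  "ctx_ge \<Omega> m \<longleftrightarrow> (\<forall>(y, B) \<in> set \<Omega>. mode B \<ge> m)"

definition normal :: "('x, 'm, 'p) ctx \<Rightarrow> bool" where
  "normal \<Omega> \<longleftrightarrow> distinct (map fst \<Omega>)"


text \<open>
  The variables of \<open>\<Gamma>\<close> are distinct, so a variable by which a rule extends \<open>\<Gamma>\<close> is fresh for \<open>\<Gamma>\<close>.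
  Well-formedness side conditions appear in those rules whose conclusion could otherwise fail to
  be a proposition; with \<open>wf_hyps \<Gamma>\<close> all propositions in a derivation are then well-formed, and
  every ordered context in it consists of hypotheses from its \<open>\<Gamma>\<close> (so that equal variables carry
  equal propositions).
\<close>

inductive explicit_nd ::
  "('m::preorder \<Rightarrow> structural set) \<Rightarrow> ('x, 'm, 'p) hyps \<Rightarrow> ('m, 'p) adj_prop \<Rightarrow>
   ('x, 'm, 'p) ctx \<Rightarrow> bool"
  for \<sigma> where
  hyp: "(x, A) \<in> \<Gamma> \<Longrightarrow> explicit_nd \<sigma> \<Gamma> A [(x, A)]"
| OneI: "explicit_nd \<sigma> \<Gamma> (One m) []"
| OneE: "\<lbrakk>explicit_nd \<sigma> \<Gamma> (One m) \<Omega>M; m \<ge> mode C; explicit_nd \<sigma> \<Gamma> C (\<Omega>L @ \<Omega>R)\<rbrakk>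
    \<Longrightarrow> explicit_nd \<sigma> \<Gamma> C (\<Omega>L @ \<Omega>M @ \<Omega>R)"
| FuseI: "\<lbrakk>explicit_nd \<sigma> \<Gamma> A \<Omega>L; explicit_nd \<sigma> \<Gamma> B \<Omega>R; wf_adj_prop (Fuse A B)\<rbrakk>
    \<Longrightarrow> explicit_nd \<sigma> \<Gamma> (Fuse A B) (\<Omega>L @ \<Omega>R)"
| FuseE: "\<lbrakk>explicit_nd \<sigma> \<Gamma> (Fuse A B) \<Omega>M; mode (Fuse A B) \<ge> mode C;
      x \<notin> hyp_vars \<Gamma>; y \<notin> hyp_vars \<Gamma>; x \<noteq> y;
      x \<notin> ctx_vars (\<Omega>L @ \<Omega>R); y \<notin> ctx_vars (\<Omega>L @ \<Omega>R);
      explicit_nd \<sigma> (\<Gamma> \<union> {(x, A), (y, B)}) C (\<Omega>L @ [(x, A), (y, B)] @ \<Omega>R)\<rbrakk>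
    \<Longrightarrow> explicit_nd \<sigma> \<Gamma> C (\<Omega>L @ \<Omega>M @ \<Omega>R)"
| PlusI1: "\<lbrakk>explicit_nd \<sigma> \<Gamma> A \<Omega>; wf_adj_prop (Plus A B)\<rbrakk>
    \<Longrightarrow> explicit_nd \<sigma> \<Gamma> (Plus A B) \<Omega>"
| PlusI2: "\<lbrakk>explicit_nd \<sigma> \<Gamma> B \<Omega>; wf_adj_prop (Plus A B)\<rbrakk>
    \<Longrightarrow> explicit_nd \<sigma> \<Gamma> (Plus A B) \<Omega>"
| PlusE: "\<lbrakk>explicit_nd \<sigma> \<Gamma> (Plus A B) \<Omega>M; mode (Plus A B) \<ge> mode C;
      x \<notin> hyp_vars \<Gamma>; x \<notin> ctx_vars (\<Omega>L @ \<Omega>R);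
      explicit_nd \<sigma> (\<Gamma> \<union> {(x, A)}) C (\<Omega>L @ [(x, A)] @ \<Omega>R);
      explicit_nd \<sigma> (\<Gamma> \<union> {(x, B)}) C (\<Omega>L @ [(x, B)] @ \<Omega>R)\<rbrakk>
    \<Longrightarrow> explicit_nd \<sigma> \<Gamma> C (\<Omega>L @ \<Omega>M @ \<Omega>R)"
| DownI: "\<lbrakk>explicit_nd \<sigma> \<Gamma> A \<Omega>; wf_adj_prop (Down m A)\<rbrakk>
    \<Longrightarrow> explicit_nd \<sigma> \<Gamma> (Down m A) \<Omega>"
| DownE: "\<lbrakk>explicit_nd \<sigma> \<Gamma> (Down m A) \<Omega>M; m \<ge> mode C;
      x \<notin> hyp_vars \<Gamma>; x \<notin> ctx_vars (\<Omega>L @ \<Omega>R);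
      explicit_nd \<sigma> (\<Gamma> \<union> {(x, A)}) C (\<Omega>L @ [(x, A)] @ \<Omega>R)\<rbrakk>
    \<Longrightarrow> explicit_nd \<sigma> \<Gamma> C (\<Omega>L @ \<Omega>M @ \<Omega>R)"
| ImpRI: "\<lbrakk>explicit_nd \<sigma> (\<Gamma> \<union> {(x, A)}) B (\<Omega> @ [(x, A)]);
      x \<notin> hyp_vars \<Gamma>; x \<notin> ctx_vars \<Omega>; wf_adj_prop (ImpR A B)\<rbrakk>
    \<Longrightarrow> explicit_nd \<sigma> \<Gamma> (ImpR A B) \<Omega>"
| ImpRE: "\<lbrakk>explicit_nd \<sigma> \<Gamma> (ImpR A B) \<Omega>L; explicit_nd \<sigma> \<Gamma> A \<Omega>R\<rbrakk>
    \<Longrightarrow> explicit_nd \<sigma> \<Gamma> B (\<Omega>L @ \<Omega>R)"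
| ImpLI: "\<lbrakk>explicit_nd \<sigma> (\<Gamma> \<union> {(x, A)}) B ([(x, A)] @ \<Omega>);
      x \<notin> hyp_vars \<Gamma>; x \<notin> ctx_vars \<Omega>; wf_adj_prop (ImpL A B)\<rbrakk>
    \<Longrightarrow> explicit_nd \<sigma> \<Gamma> (ImpL A B) \<Omega>"
| ImpLE: "\<lbrakk>explicit_nd \<sigma> \<Gamma> (ImpL A B) \<Omega>R; explicit_nd \<sigma> \<Gamma> A \<Omega>L\<rbrakk>
    \<Longrightarrow> explicit_nd \<sigma> \<Gamma> B (\<Omega>L @ \<Omega>R)"
| WithI: "\<lbrakk>explicit_nd \<sigma> \<Gamma> A \<Omega>; explicit_nd \<sigma> \<Gamma> B \<Omega>; wf_adj_prop (With A B)\<rbrakk>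
    \<Longrightarrow> explicit_nd \<sigma> \<Gamma> (With A B) \<Omega>"
| WithE1: "explicit_nd \<sigma> \<Gamma> (With A B) \<Omega> \<Longrightarrow> explicit_nd \<sigma> \<Gamma> A \<Omega>"
| WithE2: "explicit_nd \<sigma> \<Gamma> (With A B) \<Omega> \<Longrightarrow> explicit_nd \<sigma> \<Gamma> B \<Omega>"
| UpI: "\<lbrakk>explicit_nd \<sigma> \<Gamma> A \<Omega>; ctx_ge \<Omega> m; wf_adj_prop (Up m A)\<rbrakk>
    \<Longrightarrow> explicit_nd \<sigma> \<Gamma> (Up m A) \<Omega>"
| UpE: "explicit_nd \<sigma> \<Gamma> (Up m A) \<Omega> \<Longrightarrow> explicit_nd \<sigma> \<Gamma> A \<Omega>"
| weak: "\<lbrakk>explicit_nd \<sigma> \<Gamma> C (\<Omega>L @ \<Omega>R); (x, A) \<in> \<Gamma>; mode A \<ge> mode C; Weak \<in> \<sigma> (mode A)\<rbrakk>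
    \<Longrightarrow> explicit_nd \<sigma> \<Gamma> C (\<Omega>L @ [(x, A)] @ \<Omega>R)"
| contrR: "\<lbrakk>explicit_nd \<sigma> \<Gamma> C (\<Omega>L @ [(x, A)] @ \<Omega>M @ [(x, A)] @ \<Omega>R); ContrR \<in> \<sigma> (mode A)\<rbrakk>
    \<Longrightarrow> explicit_nd \<sigma> \<Gamma> C (\<Omega>L @ \<Omega>M @ [(x, A)] @ \<Omega>R)"
| contrL: "\<lbrakk>explicit_nd \<sigma> \<Gamma> C (\<Omega>L @ [(x, A)] @ \<Omega>M @ [(x, A)] @ \<Omega>R); ContrL \<in> \<sigma> (mode A)\<rbrakk>
    \<Longrightarrow> explicit_nd \<sigma> \<Gamma> C (\<Omega>L @ [(x, A)] @ \<Omega>M @ \<Omega>R)"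
| moveR: "\<lbrakk>explicit_nd \<sigma> \<Gamma> C (\<Omega>L @ [(x, A)] @ \<Omega>M @ \<Omega>R); MoveR \<in> \<sigma> (mode A)\<rbrakk>
    \<Longrightarrow> explicit_nd \<sigma> \<Gamma> C (\<Omega>L @ \<Omega>M @ [(x, A)] @ \<Omega>R)"
| moveL: "\<lbrakk>explicit_nd \<sigma> \<Gamma> C (\<Omega>L @ \<Omega>M @ [(x, A)] @ \<Omega>R); MoveL \<in> \<sigma> (mode A)\<rbrakk>
    \<Longrightarrow> explicit_nd \<sigma> \<Gamma> C (\<Omega>L @ [(x, A)] @ \<Omega>M @ \<Omega>R)"


inductive reduces ::
  "('m::preorder \<Rightarrow> structural set) \<Rightarrow> ('x, 'm, 'p) hyps \<Rightarrow> 'm \<Rightarrow>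
   ('x, 'm, 'p) ctx \<Rightarrow> ('x, 'm, 'p) ctx \<Rightarrow> bool"
  for \<sigma> \<Gamma> r where
  weak: "\<lbrakk>reduces \<sigma> \<Gamma> r (\<Omega>L @ [(x, A)] @ \<Omega>R) \<Omega>'; Weak \<in> \<sigma> (mode A); mode A \<ge> r;
      (x, A) \<in> \<Gamma>; x \<notin> ctx_vars (\<Omega>L @ \<Omega>R)\<rbrakk>
    \<Longrightarrow> reduces \<sigma> \<Gamma> r (\<Omega>L @ \<Omega>R) \<Omega>'"
| contrL: "\<lbrakk>reduces \<sigma> \<Gamma> r (\<Omega>L @ [(x, A)] @ \<Omega>M @ \<Omega>R) \<Omega>'; ContrL \<in> \<sigma> (mode A)\<rbrakk>
    \<Longrightarrow> reduces \<sigma> \<Gamma> r (\<Omega>L @ [(x, A)] @ \<Omega>M @ [(x, A)] @ \<Omega>R) \<Omega>'"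
| contrR: "\<lbrakk>reduces \<sigma> \<Gamma> r (\<Omega>L @ \<Omega>M @ [(x, A)] @ \<Omega>R) \<Omega>'; ContrR \<in> \<sigma> (mode A)\<rbrakk>
    \<Longrightarrow> reduces \<sigma> \<Gamma> r (\<Omega>L @ [(x, A)] @ \<Omega>M @ [(x, A)] @ \<Omega>R) \<Omega>'"
| moveL: "\<lbrakk>reduces \<sigma> \<Gamma> r (\<Omega>L @ [(x, A)] @ \<Omega>M @ \<Omega>R) \<Omega>'; MoveL \<in> \<sigma> (mode A)\<rbrakk>
    \<Longrightarrow> reduces \<sigma> \<Gamma> r (\<Omega>L @ \<Omega>M @ [(x, A)] @ \<Omega>R) \<Omega>'"
| moveR: "\<lbrakk>reduces \<sigma> \<Gamma> r (\<Omega>L @ \<Omega>M @ [(x, A)] @ \<Omega>R) \<Omega>'; MoveR \<in> \<sigma> (mode A)\<rbrakk>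
    \<Longrightarrow> reduces \<sigma> \<Gamma> r (\<Omega>L @ [(x, A)] @ \<Omega>M @ \<Omega>R) \<Omega>'"
| id: "normal \<Omega> \<Longrightarrow> reduces \<sigma> \<Gamma> r \<Omega> \<Omega>"

definition NF ::
  "('m::preorder \<Rightarrow> structural set) \<Rightarrow> ('x, 'm, 'p) hyps \<Rightarrow> 'm \<Rightarrow>
   ('x, 'm, 'p) ctx set \<Rightarrow> ('x, 'm, 'p) ctx set" where
  "NF \<sigma> \<Gamma> r \<Xi> = (\<Union>\<Omega>\<in>\<Xi>. {\<Omega>'. reduces \<sigma> \<Gamma> r \<Omega> \<Omega>'})"

definition ctx_concat ::
  "('x, 'm, 'p) ctx set \<Rightarrow> ('x, 'm, 'p) ctx set \<Rightarrow> ('x, 'm, 'p) ctx set" where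
  "ctx_concat \<Xi>1 \<Xi>2 = {\<Omega>1 @ \<Omega>2 |\<Omega>1 \<Omega>2. \<Omega>1 \<in> \<Xi>1 \<and> \<Omega>2 \<in> \<Xi>2}"

definition ctx_restrict ::
  "('x, 'm::preorder, 'p) ctx set \<Rightarrow> 'm \<Rightarrow> ('x, 'm, 'p) ctx set" where
  "ctx_restrict \<Xi> m = {\<Omega> \<in> \<Xi>. ctx_ge \<Omega> m}"


text \<open>
  The premise \<open>\<Xi> \<noteq> {}\<close> expresses that a rule applies only if its output set is nonempty.
\<close>

inductive implicit_nd ::
  "('m::preorder \<Rightarrow> structural set) \<Rightarrow> ('x, 'm, 'p) hyps \<Rightarrow> ('m, 'p) adj_prop \<Rightarrow>
   ('x, 'm, 'p) ctx set \<Rightarrow> bool"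
  for \<sigma> where
  hyp: "\<lbrakk>(x, A) \<in> \<Gamma>; \<Xi> = NF \<sigma> \<Gamma> (mode A) {[(x, A)]}; \<Xi> \<noteq> {}\<rbrakk>
    \<Longrightarrow> implicit_nd \<sigma> \<Gamma> A \<Xi>"
| OneI: "\<lbrakk>\<Xi> = NF \<sigma> \<Gamma> m {[]}; \<Xi> \<noteq> {}\<rbrakk> \<Longrightarrow> implicit_nd \<sigma> \<Gamma> (One m) \<Xi>"
| OneE: "\<lbrakk>implicit_nd \<sigma> \<Gamma> (One m) \<Xi>M; m \<ge> mode C; implicit_nd \<sigma> \<Gamma> C \<Xi>';
      \<Xi> = NF \<sigma> \<Gamma> (mode C)
        {\<Omega>L @ \<Omega>M @ \<Omega>R |\<Omega>L \<Omega>M \<Omega>R. \<Omega>L @ \<Omega>R \<in> \<Xi>' \<and> \<Omega>M \<in> \<Xi>M}; \<Xi> \<noteq> {}\<rbrakk>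
    \<Longrightarrow> implicit_nd \<sigma> \<Gamma> C \<Xi>"
| FuseI: "\<lbrakk>implicit_nd \<sigma> \<Gamma> A \<Xi>L; implicit_nd \<sigma> \<Gamma> B \<Xi>R; wf_adj_prop (Fuse A B);
      \<Xi> = NF \<sigma> \<Gamma> (mode (Fuse A B)) (ctx_concat \<Xi>L \<Xi>R); \<Xi> \<noteq> {}\<rbrakk>
    \<Longrightarrow> implicit_nd \<sigma> \<Gamma> (Fuse A B) \<Xi>"
| FuseE: "\<lbrakk>implicit_nd \<sigma> \<Gamma> (Fuse A B) \<Xi>M; mode (Fuse A B) \<ge> mode C;
      x \<notin> hyp_vars \<Gamma>; y \<notin> hyp_vars \<Gamma>; x \<noteq> y;
      implicit_nd \<sigma> (\<Gamma> \<union> {(x, A), (y, B)}) C \<Xi>';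
      \<Xi> = NF \<sigma> \<Gamma> (mode C)
        {\<Omega>L @ \<Omega>M @ \<Omega>R |\<Omega>L \<Omega>M \<Omega>R. \<Omega>L @ [(x, A), (y, B)] @ \<Omega>R \<in> \<Xi>' \<and> \<Omega>M \<in> \<Xi>M};
      \<Xi> \<noteq> {}\<rbrakk>
    \<Longrightarrow> implicit_nd \<sigma> \<Gamma> C \<Xi>"
| PlusI1: "\<lbrakk>implicit_nd \<sigma> \<Gamma> A \<Xi>; wf_adj_prop (Plus A B); \<Xi> \<noteq> {}\<rbrakk>
    \<Longrightarrow> implicit_nd \<sigma> \<Gamma> (Plus A B) \<Xi>"
| PlusI2: "\<lbrakk>implicit_nd \<sigma> \<Gamma> B \<Xi>; wf_adj_prop (Plus A B); \<Xi> \<noteq> {}\<rbrakk>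
    \<Longrightarrow> implicit_nd \<sigma> \<Gamma> (Plus A B) \<Xi>"
| PlusE: "\<lbrakk>implicit_nd \<sigma> \<Gamma> (Plus A B) \<Xi>M; mode (Plus A B) \<ge> mode C; x \<notin> hyp_vars \<Gamma>;
      implicit_nd \<sigma> (\<Gamma> \<union> {(x, A)}) C \<Xi>A; implicit_nd \<sigma> (\<Gamma> \<union> {(x, B)}) C \<Xi>B;
      \<Xi> = NF \<sigma> \<Gamma> (mode C)
        {\<Omega>L @ \<Omega>M @ \<Omega>R |\<Omega>L \<Omega>M \<Omega>R.
          \<Omega>L @ [(x, A)] @ \<Omega>R \<in> \<Xi>A \<and> \<Omega>L @ [(x, B)] @ \<Omega>R \<in> \<Xi>B \<and> \<Omega>M \<in> \<Xi>M};
      \<Xi> \<noteq> {}\<rbrakk>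
    \<Longrightarrow> implicit_nd \<sigma> \<Gamma> C \<Xi>"
| DownI: "\<lbrakk>implicit_nd \<sigma> \<Gamma> A \<Xi>'; wf_adj_prop (Down m A); \<Xi> = NF \<sigma> \<Gamma> m \<Xi>'; \<Xi> \<noteq> {}\<rbrakk>
    \<Longrightarrow> implicit_nd \<sigma> \<Gamma> (Down m A) \<Xi>"
| DownE: "\<lbrakk>implicit_nd \<sigma> \<Gamma> (Down m A) \<Xi>M; m \<ge> mode C; x \<notin> hyp_vars \<Gamma>;
      implicit_nd \<sigma> (\<Gamma> \<union> {(x, A)}) C \<Xi>';
      \<Xi> = NF \<sigma> \<Gamma> (mode C)
        {\<Omega>L @ \<Omega>M @ \<Omega>R |\<Omega>L \<Omega>M \<Omega>R. \<Omega>L @ [(x, A)] @ \<Omega>R \<in> \<Xi>' \<and> \<Omega>M \<in> \<Xi>M};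
      \<Xi> \<noteq> {}\<rbrakk>
    \<Longrightarrow> implicit_nd \<sigma> \<Gamma> C \<Xi>"
| ImpRI: "\<lbrakk>implicit_nd \<sigma> (\<Gamma> \<union> {(x, A)}) B \<Xi>'; x \<notin> hyp_vars \<Gamma>; wf_adj_prop (ImpR A B);
      \<Xi> = {\<Omega>. \<Omega> @ [(x, A)] \<in> \<Xi>'}; \<Xi> \<noteq> {}\<rbrakk>
    \<Longrightarrow> implicit_nd \<sigma> \<Gamma> (ImpR A B) \<Xi>"
| ImpRE: "\<lbrakk>implicit_nd \<sigma> \<Gamma> (ImpR A B) \<Xi>L; implicit_nd \<sigma> \<Gamma> A \<Xi>R;
      \<Xi> = NF \<sigma> \<Gamma> (mode B) (ctx_concat \<Xi>L \<Xi>R); \<Xi> \<noteq> {}\<rbrakk>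
    \<Longrightarrow> implicit_nd \<sigma> \<Gamma> B \<Xi>"
| ImpLI: "\<lbrakk>implicit_nd \<sigma> (\<Gamma> \<union> {(x, A)}) B \<Xi>'; x \<notin> hyp_vars \<Gamma>; wf_adj_prop (ImpL A B);
      \<Xi> = {\<Omega>. [(x, A)] @ \<Omega> \<in> \<Xi>'}; \<Xi> \<noteq> {}\<rbrakk>
    \<Longrightarrow> implicit_nd \<sigma> \<Gamma> (ImpL A B) \<Xi>"
| ImpLE: "\<lbrakk>implicit_nd \<sigma> \<Gamma> (ImpL A B) \<Xi>R; implicit_nd \<sigma> \<Gamma> A \<Xi>L;
      \<Xi> = NF \<sigma> \<Gamma> (mode B) (ctx_concat \<Xi>L \<Xi>R); \<Xi> \<noteq> {}\<rbrakk>
    \<Longrightarrow> implicit_nd \<sigma> \<Gamma> B \<Xi>"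
| WithI: "\<lbrakk>implicit_nd \<sigma> \<Gamma> A \<Xi>A; implicit_nd \<sigma> \<Gamma> B \<Xi>B; wf_adj_prop (With A B);
      \<Xi> = \<Xi>A \<inter> \<Xi>B; \<Xi> \<noteq> {}\<rbrakk>
    \<Longrightarrow> implicit_nd \<sigma> \<Gamma> (With A B) \<Xi>"
| WithE1: "\<lbrakk>implicit_nd \<sigma> \<Gamma> (With A B) \<Xi>; \<Xi> \<noteq> {}\<rbrakk> \<Longrightarrow> implicit_nd \<sigma> \<Gamma> A \<Xi>"
| WithE2: "\<lbrakk>implicit_nd \<sigma> \<Gamma> (With A B) \<Xi>; \<Xi> \<noteq> {}\<rbrakk> \<Longrightarrow> implicit_nd \<sigma> \<Gamma> B \<Xi>"
| UpI: "\<lbrakk>implicit_nd \<sigma> \<Gamma> A \<Xi>'; wf_adj_prop (Up m A); \<Xi> = ctx_restrict \<Xi>' m; \<Xi> \<noteq> {}\<rbrakk>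
    \<Longrightarrow> implicit_nd \<sigma> \<Gamma> (Up m A) \<Xi>"
| UpE: "\<lbrakk>implicit_nd \<sigma> \<Gamma> (Up m A) \<Xi>'; \<Xi> = NF \<sigma> \<Gamma> (mode A) \<Xi>'; \<Xi> \<noteq> {}\<rbrakk>
    \<Longrightarrow> implicit_nd \<sigma> \<Gamma> A \<Xi>"

end

theory Submission
  imports Defs
begin

text \<open>
  A context reduction replays as a sequence of explicit structural rules, and the remaining
  implicit rules are the explicit ones applied pointwise.  The explicit freshness conditions
  \<open>x \<notin> |\<Omega>\<^sub>L \<Omega>\<^sub>R|\<close> hold because every context in \<open>\<Xi>\<close> is normal.
\<close>

text \<open>Only \<open>id\<close> ends a reduction, and it demands normality; every other rule
  passes the target through unchanged.\<close>

lemma reduces_normal: "reduces \<sigma> \<Gamma> r \<Omega> \<Omega>' \<Longrightarrow> normal \<Omega>'"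
  by (induction rule: reduces.induct)

lemma NF_normal: "\<Omega> \<in> NF \<sigma> \<Gamma> r \<Xi> \<Longrightarrow> normal \<Omega>"
  by (auto simp: NF_def intro: reduces_normal)

text \<open>Rules whose output is not an \<open>NF\<close> keep contexts of a premise, select among
  them, or strip one end hypothesis; none of this can create a repeated variable.\<close>

lemma implicit_nd_normal:
  "implicit_nd \<sigma> \<Gamma> C \<Xi> \<Longrightarrow> \<Omega> \<in> \<Xi> \<Longrightarrow> normal \<Omega>"
proof (induction arbitrary: \<Omega> rule: implicit_nd.induct)
  case ImpRI
  then show ?case by (fastforce simp: normal_def)
next
  case ImpLI
  then show ?case by (fastforce simp: normal_def)
qed (auto simp: ctx_restrict_def dest: NF_normal)

text \<open>Read from source to target, each reduction step is the explicit structural rule of the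
  same name. The index is \<open>mode C\<close> so that the mode condition of \<open>weak\<close> is
  exactly the one the explicit rule requires.\<close>

lemma explicit_nd_reduces:
  assumes "reduces \<sigma> \<Gamma> (mode C) \<Omega> \<Omega>'" "explicit_nd \<sigma> \<Gamma> C \<Omega>"
  shows "explicit_nd \<sigma> \<Gamma> C \<Omega>'"
  using assms
proof (induction rule: reduces.induct)
  case weak
  then show ?case by (blast intro: explicit_nd.weak)
next
  case contrL
  then show ?case by (blast intro: explicit_nd.contrL)
next
  case contrR
  then show ?case by (blast intro: explicit_nd.contrR)
next
  case moveL
  then show ?case by (blast intro: explicit_nd.moveL)
next
  case moveR
  then show ?case by (blast intro: explicit_nd.moveR)
qed

text \<open>Thanks to this, a rule with an \<open>NF\<close> output needs checking only on the
  contexts before reduction.\<close>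

lemma explicit_nd_NF:
  assumes "\<Omega> \<in> NF \<sigma> \<Gamma> (mode C) \<Xi>" "\<And>\<Omega>'. \<Omega>' \<in> \<Xi> \<Longrightarrow> explicit_nd \<sigma> \<Gamma> C \<Omega>'"
  shows "explicit_nd \<sigma> \<Gamma> C \<Omega>"
  using assms by (auto simp: NF_def intro: explicit_nd_reduces)

lemma implicit_nd_imp_explicit_nd:
  "implicit_nd \<sigma> \<Gamma> C \<Xi> \<Longrightarrow> \<Omega> \<in> \<Xi> \<Longrightarrow> explicit_nd \<sigma> \<Gamma> C \<Omega>"
proof (induction arbitrary: \<Omega> rule: implicit_nd.induct)
  case hyp
  then show ?case by (auto intro: explicit_nd_NF explicit_nd.hyp)
next
  case (OneI \<Xi> \<Gamma> m)
  \<comment> \<open>The index \<open>m\<close> is rewritten as the mode of the conclusion, the form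
    that \<open>explicit_nd_NF\<close> expects.\<close>
  then have "\<Omega> \<in> NF \<sigma> \<Gamma> (mode (One m)) {[]}" by simp
  then show ?case by (rule explicit_nd_NF) (auto intro: explicit_nd.OneI)
next
  case OneE
  \<comment> \<open>Unfolding the equation for \<Xi> exposes its \<open>NF\<close>.\<close>
  from OneE.prems[unfolded OneE.hyps] show ?case
    by (rule explicit_nd_NF) (use OneE in \<open>auto intro: explicit_nd.OneE\<close>)
next
  case FuseI
  from FuseI.prems[unfolded FuseI.hyps] show ?case
    by (rule explicit_nd_NF) (use FuseI in \<open>auto simp: ctx_concat_def intro: explicit_nd.FuseI\<close>)
next
  case (FuseE \<Gamma> A B \<Xi>M C x y \<Xi>' \<Xi>)
  from FuseE.prems[unfolded FuseE.hyps] show ?case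
  proof (rule explicit_nd_NF, clarify)
    fix \<Omega>L \<Omega>M \<Omega>R
    assume in_\<Xi>': "\<Omega>L @ [(x, A), (y, B)] @ \<Omega>R \<in> \<Xi>'" and "\<Omega>M \<in> \<Xi>M"
    \<comment> \<open>Normality is used on the premise context, where \<open>x\<close> and
      \<open>y\<close> have not yet been replaced by \<open>\<Omega>M\<close>: each occurs there
      once, hence not in the surrounding parts.\<close>
    have "normal (\<Omega>L @ [(x, A), (y, B)] @ \<Omega>R)"
      using FuseE.hyps in_\<Xi>' implicit_nd_normal by blast
    then have fresh: "x \<notin> ctx_vars (\<Omega>L @ \<Omega>R)" "y \<notin> ctx_vars (\<Omega>L @ \<Omega>R)"
      by (auto simp: normal_def)
    from FuseE.IH(1)[OF \<open>\<Omega>M \<in> \<Xi>M\<close>] FuseE.hyps(2-5) fresh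
    show "explicit_nd \<sigma> \<Gamma> C (\<Omega>L @ \<Omega>M @ \<Omega>R)"
      using FuseE.IH(2)[OF in_\<Xi>'] by (rule explicit_nd.FuseE)
  qed
next
  case PlusI1
  then show ?case by (auto intro: explicit_nd.PlusI1)
next
  case PlusI2
  then show ?case by (auto intro: explicit_nd.PlusI2)
next
  case (PlusE \<Gamma> A B \<Xi>M C x \<Xi>A \<Xi>B \<Xi>)
  from PlusE.prems[unfolded PlusE.hyps] show ?case
  proof (rule explicit_nd_NF, clarify)
    fix \<Omega>L \<Omega>M \<Omega>R
    assume in_\<Xi>: "\<Omega>L @ [(x, A)] @ \<Omega>R \<in> \<Xi>A" "\<Omega>L @ [(x, B)] @ \<Omega>R \<in> \<Xi>B" and "\<Omega>M \<in> \<Xi>M"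
    \<comment> \<open>One branch suffices, since both share \<open>\<Omega>L\<close> and
      \<open>\<Omega>R\<close>.\<close>
    have "normal (\<Omega>L @ [(x, A)] @ \<Omega>R)"
      using PlusE.hyps in_\<Xi> implicit_nd_normal by blast
    then have fresh: "x \<notin> ctx_vars (\<Omega>L @ \<Omega>R)"
      by (auto simp: normal_def)
    from PlusE.IH(1)[OF \<open>\<Omega>M \<in> \<Xi>M\<close>] PlusE.hyps(2,3) fresh
    show "explicit_nd \<sigma> \<Gamma> C (\<Omega>L @ \<Omega>M @ \<Omega>R)"
      using PlusE.IH(2)[OF in_\<Xi>(1)] PlusE.IH(3)[OF in_\<Xi>(2)] by (rule explicit_nd.PlusE)
  qed
next
  case (DownI \<Gamma> A \<Xi>' m \<Xi>)
  then have "\<Omega> \<in> NF \<sigma> \<Gamma> (mode (Down m A)) \<Xi>'" by simp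
  then show ?case
    by (rule explicit_nd_NF) (use DownI in \<open>auto intro: explicit_nd.DownI\<close>)
next
  case (DownE \<Gamma> m A \<Xi>M C x \<Xi>' \<Xi>)
  from DownE.prems[unfolded DownE.hyps] show ?case
  proof (rule explicit_nd_NF, clarify)
    fix \<Omega>L \<Omega>M \<Omega>R
    assume in_\<Xi>': "\<Omega>L @ [(x, A)] @ \<Omega>R \<in> \<Xi>'" and "\<Omega>M \<in> \<Xi>M"
    have "normal (\<Omega>L @ [(x, A)] @ \<Omega>R)"
      using DownE.hyps in_\<Xi>' implicit_nd_normal by blast
    then have fresh: "x \<notin> ctx_vars (\<Omega>L @ \<Omega>R)"
      by (auto simp: normal_def)
    from DownE.IH(1)[OF \<open>\<Omega>M \<in> \<Xi>M\<close>] DownE.hyps(2,3) fresh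
    show "explicit_nd \<sigma> \<Gamma> C (\<Omega>L @ \<Omega>M @ \<Omega>R)"
      using DownE.IH(2)[OF in_\<Xi>'] by (rule explicit_nd.DownE)
  qed
next
  case (ImpRI \<Gamma> x A B \<Xi>' \<Xi>)
  \<comment> \<open>No reduction intervenes here: \<Omega> extended by the discharged hypothesis is
    itself a context of the premise, so normality of that context gives freshness.\<close>
  then have in_\<Xi>': "\<Omega> @ [(x, A)] \<in> \<Xi>'" by blast
  with ImpRI.hyps have "normal (\<Omega> @ [(x, A)])"
    using implicit_nd_normal by blast
  then have "x \<notin> ctx_vars \<Omega>" by (auto simp: normal_def)
  with ImpRI in_\<Xi>' show ?case by (blast intro: explicit_nd.ImpRI)
next
  case ImpRE
  from ImpRE.prems[unfolded ImpRE.hyps] show ?case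
    by (rule explicit_nd_NF) (use ImpRE in \<open>auto simp: ctx_concat_def intro: explicit_nd.ImpRE\<close>)
next
  case (ImpLI \<Gamma> x A B \<Xi>' \<Xi>)
  then have in_\<Xi>': "[(x, A)] @ \<Omega> \<in> \<Xi>'" by blast
  with ImpLI.hyps have "normal ([(x, A)] @ \<Omega>)"
    using implicit_nd_normal by blast
  then have "x \<notin> ctx_vars \<Omega>" by (auto simp: normal_def)
  with ImpLI in_\<Xi>' show ?case by (blast intro: explicit_nd.ImpLI)
next
  case ImpLE
  from ImpLE.prems[unfolded ImpLE.hyps] show ?case
    by (rule explicit_nd_NF) (use ImpLE in \<open>auto simp: ctx_concat_def intro: explicit_nd.ImpLE\<close>)
next
  case WithI
  then show ?case by (auto intro: explicit_nd.WithI)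
next
  case WithE1
  then show ?case by (auto intro: explicit_nd.WithE1)
next
  case WithE2
  then show ?case by (auto intro: explicit_nd.WithE2)
next
  case UpI
  then show ?case by (auto simp: ctx_restrict_def intro: explicit_nd.UpI)
next
  case UpE
  from UpE.prems[unfolded UpE.hyps] show ?case
    by (rule explicit_nd_NF) (use UpE in \<open>auto intro: explicit_nd.UpE\<close>)
qed

theorem theorem8:
  fixes \<sigma> :: "'m::preorder \<Rightarrow> structural set"
    and \<Gamma> :: "('x, 'm, 'p) hyps"
    and C :: "('m, 'p) adj_prop"
    and \<Xi> :: "('x, 'm, 'p) ctx set"
  assumes "structural_modes \<sigma>"
    and "wf_hyps \<Gamma>"
    and "implicit_nd \<sigma> \<Gamma> C \<Xi>"
  shows "\<forall>\<Omega>\<in>\<Xi>. explicit_nd \<sigma> \<Gamma> C \<Omega>"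
  using assms(3) by (blast intro: implicit_nd_imp_explicit_nd)

end
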